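(* Let $p$ be a prime and let $(w_n)_{n\ge 1}$ be a sequence of positive integers. For each $n$, let $\overline{\mathbf{B}}_n$ be a uniform random element of the set $$\{B\in M_n(\mathbb{F}_p): B(i,j)=0\text{ for all } i,j\text{ such that } |i-j|>w_n\}.$$ The sequence of random variables $$\frac{\dim\ker\overline{\mathbf{B}}_n}{n}$$ converges to $0$ in probability if and only if $\lim_{n\to\infty}w_n=\infty$.
   Context: $\ker\overline{\mathbf{B}}_n=\{v\in\mathbb{F}_p^n:\overline{\mathbf{B}}_nv=0\}$, and $\dim$ is dimension over $\mathbb{F}_p$. *)

theory Defs
  imports
    "HOL-Probability.Probability"
    "Jordan_Normal_Form.Matrix_Kernel"
    "Berlekamp_Zassenhaus.Finite_Field"
begin

(* Rows and columns are numbered from 0; the condition depends only on the difference i - j. *)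
definition band_matrices :: "nat \<Rightarrow> nat \<Rightarrow> 'a::zero mat set" where
  "band_matrices n w =
     {A \<in> carrier_mat n n. \<forall>i<n. \<forall>j<n. \<bar>int i - int j\<bar> > int w \<longrightarrow> A $$ (i, j) = 0}"

definition uniform_random_element :: "'w measure \<Rightarrow> 'a set \<Rightarrow> ('w \<Rightarrow> 'a) \<Rightarrow> bool" where
  "uniform_random_element M S X \<longleftrightarrow>
     X \<in> measurable M (count_space S) \<and> distr M (count_space S) X = uniform_count_measure S"

(* The variables X n may live on different probability spaces M n: convergence in probability
   to a constant depends only on the law of each X n. *)
definition tendsto_in_probability ::
    "(nat \<Rightarrow> 'w measure) \<Rightarrow> (nat \<Rightarrow> 'w \<Rightarrow> real) \<Rightarrow> real \<Rightarrow> bool" where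
  "tendsto_in_probability M X c \<longleftrightarrow>
     (\<forall>\<epsilon>>0. (\<lambda>n. measure (M n) {\<omega> \<in> space (M n). \<bar>X n \<omega> - c\<bar> > \<epsilon>}) \<longlonglongrightarrow> 0)"

end

theory Submission
  imports Defs "HOL-Real_Asymp.Real_Asymp"
begin

text \<open>
  Everything is read off from \<open>|ker B| = p ^ dim ker B\<close>.

  If \<open>w n\<close> tends to infinity, bound the expected size of the kernel, i.e. the sum over all vectors \<open>v\<close>
  of the probability of \<open>B v = 0\<close>. This probability is \<open>p\<close> to minus the number of rows whose band
  meets the support of \<open>v\<close>. Grouping the \<open>v\<close> by the set of blocks of length \<open>w + 1\<close> they meet, each group
  contributes at most 1, so the expectation is at most 2 to the number of blocks, which is
  \<open>exp (o(n))\<close>, and Markov's inequality concludes.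

  If \<open>w n \<le> K\<close> for infinitely many \<open>n\<close>, then each column vanishes with probability at least
  \<open>c = p ^ - (2 K + 1)\<close>, so \<open>dim ker B / n\<close>, which lies between 0 and 1, has expectation at least \<open>c\<close>
  and therefore exceeds \<open>c / 2\<close> with probability at least \<open>c / 2\<close>.
\<close>

section \<open>Counting matrices, vectors and kernels over a finite field\<close>

lemma finite_carrier_mat: "finite (carrier_mat m n :: 'a::finite mat set)"
proof -
  let ?f = "\<lambda>A :: 'a mat. restrict (\<lambda>ij. A $$ ij) ({..<m} \<times> {..<n})"
  have "inj_on ?f (carrier_mat m n)"
  proof (rule inj_onI)
    fix A B :: "'a mat"
    assume A: "A \<in> carrier_mat m n" and B: "B \<in> carrier_mat m n" and eq: "?f A = ?f B"
    show "A = B"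
    proof (rule eq_matI)
      fix i j assume "i < dim_row B" "j < dim_col B"
      then show "A $$ (i, j) = B $$ (i, j)"
        using fun_cong[OF eq, of "(i, j)"] B by simp
    qed (use A B in auto)
  qed
  moreover have "?f ` carrier_mat m n \<subseteq> ({..<m} \<times> {..<n}) \<rightarrow>\<^sub>E UNIV"
    by (auto split: if_splits)
  ultimately show ?thesis
    by (rule inj_on_finite) (intro finite_PiE; simp)
qed

text \<open>Restriction to \<open>U\<close> is a bijection onto the functions on \<open>U\<close>.
  Applied with \<open>U\<close> a union of blocks, with \<open>U\<close> a set of zero columns, and
  with \<open>U = {..<n}\<close> for the finiteness of the whole space.\<close>

lemma card_vecs_supported_in:
  assumes "U \<subseteq> {..<n}"
  shows "finite {v \<in> carrier_vec n. \<forall>i<n. i \<notin> U \<longrightarrow> v $ i = (0 :: 'a::{finite,zero})}"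
    and "card {v \<in> carrier_vec n. \<forall>i<n. i \<notin> U \<longrightarrow> v $ i = (0 :: 'a::{finite,zero})}
           = CARD('a) ^ card U"
proof -
  let ?V = "{v \<in> carrier_vec n. \<forall>i<n. i \<notin> U \<longrightarrow> v $ i = (0 :: 'a)}"
  have U: "finite U" using assms finite_subset by blast
  have bij: "bij_betw (\<lambda>v. restrict (($) v) U) ?V (U \<rightarrow>\<^sub>E UNIV)"
  proof (rule bij_betw_byWitness[where f' = "\<lambda>f. vec n (\<lambda>i. if i \<in> U then f i else 0)"])
    show "\<forall>v\<in>?V. vec n (\<lambda>i. if i \<in> U then restrict (($) v) U i else 0) = v"
      by auto
    show "\<forall>f\<in>U \<rightarrow>\<^sub>E UNIV. restrict (($) (vec n (\<lambda>i. if i \<in> U then f i else 0))) U = f"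
      using assms by (auto simp: fun_eq_iff PiE_def extensional_def)
  qed auto
  then show "finite ?V"
    using bij_betw_finite[OF bij] U by (simp add: finite_PiE)
  show "card ?V = CARD('a) ^ card U"
    using bij_betw_same_card[OF bij] U by (simp add: card_PiE)
qed

text \<open>Each kernel vector has unique coordinates in a basis of the kernel, so the kernel is in
  bijection with the functions from the basis to the field. This turns dimension bounds into
  counting.\<close>

lemma card_mat_kernel:
  fixes A :: "'a::{field,finite} mat"
  assumes "A \<in> carrier_mat m n"
  shows "card (mat_kernel A) = CARD('a) ^ kernel_dim A"
proof -
  interpret K: kernel m n A by unfold_locales (rule assms)
  obtain bas where bas: "finite bas" "K.basis bas"
    using kernel_basis_exists[OF assms] by blast
  have sub: "bas \<subseteq> mat_kernel A"
    using bas(2) by (simp add: K.Ker.basis_def)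
  have crit: "\<forall>v. v \<in> mat_kernel A \<longrightarrow> (\<exists>!a. a \<in> bas \<rightarrow>\<^sub>E UNIV \<and> K.lincomb a bas = v)"
    using K.Ker.basis_criterion[OF bas(1)] sub bas(2) by simp
  have "bij_betw (\<lambda>a. K.lincomb a bas) (bas \<rightarrow>\<^sub>E UNIV) (mat_kernel A)"
    unfolding bij_betw_def
  proof (intro conjI equalityI subsetI)
    have clo: "K.lincomb a bas \<in> mat_kernel A" for a
      using K.Ker.lincomb_closed[of bas a] sub by auto
    then show "inj_on (\<lambda>a. K.lincomb a bas) (bas \<rightarrow>\<^sub>E UNIV)"
      using crit by (intro inj_onI) metis
    show "x \<in> mat_kernel A" if "x \<in> (\<lambda>a. K.lincomb a bas) ` (bas \<rightarrow>\<^sub>E UNIV)" for x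
      using that clo by auto
    show "x \<in> (\<lambda>a. K.lincomb a bas) ` (bas \<rightarrow>\<^sub>E UNIV)" if "x \<in> mat_kernel A" for x
      using that crit by blast
  qed
  from bij_betw_same_card[OF this] have "card (mat_kernel A) = CARD('a) ^ card bas"
    using bas(1) by (simp add: card_PiE)
  then show ?thesis
    using K.Ker.dim_basis[OF bas] by simp
qed

section \<open>Upper bound: the average kernel size of a band matrix\<close>

lemma finite_band_matrices: "finite (band_matrices n w :: 'a::{finite,zero} mat set)"
  unfolding band_matrices_def using finite_carrier_mat by (rule rev_finite_subset) auto

lemma zero_in_band_matrices: "0\<^sub>m n n \<in> band_matrices n w"
  by (auto simp: band_matrices_def)

lemma card_band_matrices_pos: "card (band_matrices n w :: 'a::{finite,zero} mat set) > 0"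
  using zero_in_band_matrices finite_band_matrices by (metis card_gt_0_iff empty_iff)

text \<open>Each row in \<open>U\<close> has an in-band entry facing a nonzero coordinate of
  \<open>v\<close>. Changing these \<open>card U\<close> entries freely keeps the matrix in the
  band, and different killing matrices or different changes give different results. So a uniform
  band matrix kills \<open>v\<close> with probability at most \<open>CARD('a) ^ card U\<close>
  inverted.\<close>

lemma card_band_matrices_killing:
  fixes v :: "'a::{field,finite} vec"
  assumes v: "v \<in> carrier_vec n" and U: "U \<subseteq> {..<n}"
    and near: "\<And>i. i \<in> U \<Longrightarrow> \<exists>j<n. \<bar>int i - int j\<bar> \<le> int w \<and> v $ j \<noteq> 0"
  shows "card {A \<in> band_matrices n w. A *\<^sub>v v = 0\<^sub>v n} * CARD('a) ^ card U
           \<le> card (band_matrices n w :: 'a mat set)"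
proof -
  let ?Z = "{A \<in> band_matrices n w. A *\<^sub>v v = 0\<^sub>v n}"
  obtain c where c: "\<And>i. i \<in> U \<Longrightarrow> c i < n \<and> \<bar>int i - int (c i)\<bar> \<le> int w \<and> v $ c i \<noteq> 0"
    using near by metis
  define D where "D f = mat n n (\<lambda>(i, j). if i \<in> U \<and> j = c i then f i else 0)"
    for f :: "nat \<Rightarrow> 'a"
  have D: "D f \<in> carrier_mat n n" for f by (simp add: D_def)
  have Dv: "(D f *\<^sub>v v) $ i = f i * v $ c i" if "i \<in> U" for f i
  proof -
    have "i < n" using that U by auto
    then have "(D f *\<^sub>v v) $ i = (\<Sum>j<n. (if j = c i then f i else 0) * v $ j)"
      using v that by (simp add: D_def scalar_prod_def atLeast0LessThan)
    also have "\<dots> = (\<Sum>j<n. if j = c i then f i * v $ j else 0)"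
      by (intro sum.cong) auto
    also have "\<dots> = f i * v $ c i"
      using c[OF that] by simp
    finally show ?thesis .
  qed
  have fin_U: "finite U" using U finite_subset by blast
  txt \<open>Adding \<open>D f\<close> shifts the \<open>i\<close>-th entry of the product with \<open>v\<close> by \<open>f i\<close> times a nonzero entry of
    \<open>v\<close>, so \<open>f\<close> can be read off from the product.\<close>
  have "inj_on (\<lambda>(A, f). A + D f) (?Z \<times> (U \<rightarrow>\<^sub>E UNIV))"
  proof (rule inj_onI, clarify)
    fix A f A' f'
    assume A: "A \<in> band_matrices n w" "A *\<^sub>v v = 0\<^sub>v n"
      and A': "A' \<in> band_matrices n w" "A' *\<^sub>v v = 0\<^sub>v n"
      and f: "f \<in> U \<rightarrow>\<^sub>E UNIV" and f': "f' \<in> U \<rightarrow>\<^sub>E (UNIV :: 'a set)"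
      and eq: "A + D f = A' + D f'"
    have car: "A \<in> carrier_mat n n" "A' \<in> carrier_mat n n"
      using A(1) A'(1) by (auto simp: band_matrices_def)
    have "(A + D f) *\<^sub>v v = D f *\<^sub>v v" "(A' + D f') *\<^sub>v v = D f' *\<^sub>v v"
      using add_mult_distrib_mat_vec[OF car(1) D v] add_mult_distrib_mat_vec[OF car(2) D v]
        A(2) A'(2) mult_mat_vec_carrier[OF D v] by auto
    then have "D f *\<^sub>v v = D f' *\<^sub>v v" using eq by simp
    then have "f i = f' i" if "i \<in> U" for i
      using Dv[OF that, of f] Dv[OF that, of f'] c[OF that] by simp
    then have ff: "f = f'" using f f' by (meson PiE_ext)
    have "A $$ (i, j) = A' $$ (i, j)" if "i < n" "j < n" for i j
      using arg_cong[OF eq, of "\<lambda>X. X $$ (i, j)"] that ff D[of f'] by simp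
    then show "A = A' \<and> f = f'" using ff car by (auto intro!: eq_matI)
  qed
  moreover have "(\<lambda>(A, f). A + D f) ` (?Z \<times> (U \<rightarrow>\<^sub>E UNIV)) \<subseteq> band_matrices n w"
    using c by (fastforce simp: band_matrices_def D_def)
  ultimately have "card (?Z \<times> (U \<rightarrow>\<^sub>E (UNIV :: 'a set))) \<le> card (band_matrices n w :: 'a mat set)"
    using finite_band_matrices by (rule card_inj_on_le)
  then show ?thesis
    using fin_U by (simp add: card_cartesian_product card_PiE)
qed

text \<open>Double counting of the pairs \<open>(A, v)\<close> with \<open>A v = 0\<close>, grouped
  by the set \<open>T v\<close> of blocks of length \<open>w + 1\<close> that the support of
  \<open>v\<close> meets; \<open>U \<tau>\<close> is the union of the blocks in
  \<open>\<tau>\<close>.\<close>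

lemma sum_card_mat_kernel_band:
  "(\<Sum>A\<in>band_matrices n w. card (mat_kernel (A :: 'a::{field,finite} mat)))
     \<le> 2 ^ (n div (w + 1) + 1) * card (band_matrices n w :: 'a mat set)"
proof -
  let ?S = "band_matrices n w :: 'a mat set"
  let ?V = "carrier_vec n :: 'a vec set"
  let ?q = "CARD('a)"
  define Z where "Z v = {A \<in> ?S. A *\<^sub>v v = 0\<^sub>v n}" for v
  define T where "T v = (\<lambda>i. i div (w + 1)) ` {i. i < n \<and> v $ i \<noteq> (0 :: 'a)}" for v
  define U where "U \<tau> = {i. i < n \<and> i div (w + 1) \<in> \<tau>}" for \<tau>
  have fin_V: "finite ?V"
    using card_vecs_supported_in(1)[of "{..<n}" n, where 'a = 'a] by simp
  have U: "U \<tau> \<subseteq> {..<n}" for \<tau> by (auto simp: U_def)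
  have Z: "card (Z v) * ?q ^ card (U (T v)) \<le> card ?S" if "v \<in> ?V" for v
    unfolding Z_def
  proof (rule card_band_matrices_killing[OF that U])
    fix i assume "i \<in> U (T v)"
    then obtain j where j: "j < n" "v $ j \<noteq> 0" "i div (w + 1) = j div (w + 1)"
      by (auto simp: U_def T_def)
    \<comment> \<open>Two indices in one block differ by the difference of their remainders, hence
      by at most \<open>w\<close>; this is why the blocks have length \<open>w + 1\<close>.\<close>
    define r s where "r = i mod (w + 1)" and "s = j mod (w + 1)"
    have "r < w + 1" "s < w + 1"
      by (simp_all only: r_def s_def mod_less_divisor zero_less_Suc Suc_eq_plus1[symmetric])
    moreover obtain t where "i = t + r" "j = t + s"
      unfolding r_def s_def using j(3) by (metis div_mult_mod_eq)
    ultimately have "\<bar>int i - int j\<bar> \<le> int w" by simp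
    then show "\<exists>j<n. \<bar>int i - int j\<bar> \<le> int w \<and> v $ j \<noteq> 0"
      using j by blast
  qed
  have block: "(\<Sum>v\<in>{v \<in> ?V. T v = \<tau>}. card (Z v)) \<le> card ?S" for \<tau>
  proof -
    \<comment> \<open>Vectors with \<open>T v = \<tau>\<close> are supported in
      \<open>U \<tau>\<close>, so their number is at most \<open>?q ^ card (U \<tau>)\<close>, which
      cancels the factor gained from \<open>Z\<close>.\<close>
    let ?W = "{v \<in> ?V. \<forall>i<n. i \<notin> U \<tau> \<longrightarrow> v $ i = 0}"
    have "(\<Sum>v\<in>{v \<in> ?V. T v = \<tau>}. card (Z v)) * ?q ^ card (U \<tau>)
        = (\<Sum>v\<in>{v \<in> ?V. T v = \<tau>}. card (Z v) * ?q ^ card (U (T v)))"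
      by (simp add: sum_distrib_right)
    also have "\<dots> \<le> card {v \<in> ?V. T v = \<tau>} * card ?S"
      using sum_bounded_above[of "{v \<in> ?V. T v = \<tau>}" "\<lambda>v. card (Z v) * ?q ^ card (U (T v))" "card ?S"]
      by (simp only: of_nat_id) (use Z in blast)
    also have "card {v \<in> ?V. T v = \<tau>} \<le> card ?W"
      using card_vecs_supported_in(1)[OF U] by (rule card_mono) (auto simp: T_def U_def)
    also have "card ?W = ?q ^ card (U \<tau>)"
      by (rule card_vecs_supported_in(2)[OF U])
    finally show ?thesis by (simp add: mult.commute)
  qed
  have "(\<Sum>A\<in>?S. card (mat_kernel A)) = (\<Sum>A\<in>?S. \<Sum>v\<in>{v. v \<in> ?V \<and> A *\<^sub>v v = 0\<^sub>v n}. 1)"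
    by (intro sum.cong) (auto simp: mat_kernel_def band_matrices_def intro!: arg_cong[where f = card])
  also have "\<dots> = (\<Sum>v\<in>?V. \<Sum>A\<in>{A. A \<in> ?S \<and> A *\<^sub>v v = 0\<^sub>v n}. 1)"
    by (rule sum.swap_restrict[OF finite_band_matrices fin_V])
  also have "\<dots> = (\<Sum>v\<in>?V. card (Z v))"
    by (simp add: Z_def)
  \<comment> \<open>The block numbers run from 0 to \<open>n div (w + 1)\<close> inclusive, whence
    the \<open>+ 1\<close> in the exponent.\<close>
  also have "\<dots> = (\<Sum>\<tau>\<in>Pow {..n div (w + 1)}. \<Sum>v\<in>{v \<in> ?V. T v = \<tau>}. card (Z v))"
    by (rule sum.group[symmetric]) (auto simp: T_def fin_V intro!: div_le_mono simp del: add_Suc_right)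
  also have "\<dots> \<le> (\<Sum>\<tau>\<in>Pow {..n div (w + 1)}. card ?S)"
    by (intro sum_mono block)
  also have "\<dots> = 2 ^ (n div (w + 1) + 1) * card ?S"
    by (simp add: card_Pow)
  finally show ?thesis .
qed

section \<open>Lower bound: zero columns and the kernel dimension\<close>

text \<open>A band matrix is determined by the matrix with column \<open>j\<close> erased together
  with the in-band entries of that column, of which there are at most
  \<open>2 * w + 1\<close>.\<close>

lemma card_band_matrices_zero_col:
  assumes "j < n"
  shows "card (band_matrices n w :: 'a::{finite,zero} mat set)
     \<le> card {A \<in> band_matrices n w :: 'a mat set. \<forall>i<n. A $$ (i, j) = 0} * CARD('a) ^ (2 * w + 1)"
proof -
  let ?S = "band_matrices n w :: 'a mat set"
  let ?Z = "{A \<in> ?S. \<forall>i<n. A $$ (i, j) = 0}"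
  define R where "R = {i. i < n \<and> \<bar>int i - int j\<bar> \<le> int w}"
  let ?f = "\<lambda>A :: 'a mat. (mat n n (\<lambda>(i, k). if k = j then 0 else A $$ (i, k)),
                             restrict (\<lambda>i. A $$ (i, j)) R)"
  have R: "finite R" by (simp add: R_def)
  \<comment> \<open>The subtraction truncates at 0, which only shortens the interval.\<close>
  have "R \<subseteq> {j - w..j + w}" by (auto simp: R_def)
  then have "card R \<le> card {j - w..j + w}" by (intro card_mono) auto
  then have cR: "card R \<le> 2 * w + 1" by simp
  have "inj_on ?f ?S"
  proof (rule inj_onI)
    fix A B assume A: "A \<in> ?S" and B: "B \<in> ?S" and eq: "?f A = ?f B"
    have eq1: "mat n n (\<lambda>(i, k). if k = j then 0 else A $$ (i, k))
             = mat n n (\<lambda>(i, k). if k = j then 0 else B $$ (i, k))"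
      and eq2: "restrict (\<lambda>i. A $$ (i, j)) R = restrict (\<lambda>i. B $$ (i, j)) R"
      using eq by auto
    have "A $$ (i, k) = B $$ (i, k)" if ik: "i < n" "k < n" for i k
    proof (cases "k = j")
      case False
      then show ?thesis
        using arg_cong[OF eq1, of "\<lambda>X. X $$ (i, k)"] ik by simp
    next
      case True
      show ?thesis
      proof (cases "i \<in> R")
        case True
        then show ?thesis using fun_cong[OF eq2, of i] \<open>k = j\<close> by simp
      next
        case False
        then show ?thesis
          using A B \<open>k = j\<close> ik by (auto simp: R_def band_matrices_def)
      qed
    qed
    then show "A = B"
      using A B by (auto simp: band_matrices_def intro!: eq_matI)
  qed
  moreover have "?f ` ?S \<subseteq> ?Z \<times> (R \<rightarrow>\<^sub>E UNIV)"
    using assms by (auto simp: band_matrices_def)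
  moreover have "finite (?Z \<times> (R \<rightarrow>\<^sub>E (UNIV :: 'a set)))"
    using R by (simp add: finite_band_matrices finite_PiE)
  ultimately have "card ?S \<le> card (?Z \<times> (R \<rightarrow>\<^sub>E (UNIV :: 'a set)))"
    by (rule card_inj_on_le)
  also have "\<dots> = card ?Z * CARD('a) ^ card R"
    using R by (simp add: card_cartesian_product card_PiE)
  also have "\<dots> \<le> card ?Z * CARD('a) ^ (2 * w + 1)"
    using cR by (intro mult_left_mono power_increasing) (auto simp: Suc_le_eq)
  finally show ?thesis .
qed

lemma CARD_field_gt_1: "1 < CARD('a::{field,finite})"
proof -
  have "card {0, 1 :: 'a} \<le> CARD('a)" by (intro card_mono) auto
  then show ?thesis by simp
qed

text \<open>Every vector supported on the zero columns lies in the kernel. Both sets have a power of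
  \<open>CARD('a)\<close> as cardinality, so comparing exponents suffices.\<close>

lemma card_zero_cols_le_kernel_dim:
  fixes A :: "'a::{field,finite} mat"
  assumes A: "A \<in> carrier_mat m n"
  shows "card {j. j < n \<and> (\<forall>i<m. A $$ (i, j) = 0)} \<le> kernel_dim A"
proof -
  let ?U = "{j. j < n \<and> (\<forall>i<m. A $$ (i, j) = 0)}"
  let ?W = "{v \<in> carrier_vec n. \<forall>i<n. i \<notin> ?U \<longrightarrow> v $ i = (0 :: 'a)}"
  have U: "?U \<subseteq> {..<n}" by auto
  have fin: "finite (mat_kernel A)"
    using card_vecs_supported_in(1)[of "{..<n}" n, where 'a = 'a] A
    by (auto elim!: rev_finite_subset simp: mat_kernel_def)
  have "?W \<subseteq> mat_kernel A"
    using A by (fastforce simp: mat_kernel_def scalar_prod_def intro!: eq_vecI sum.neutral)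
  then have "card ?W \<le> card (mat_kernel A)" by (rule card_mono[OF fin])
  then have "CARD('a) ^ card ?U \<le> CARD('a) ^ kernel_dim A"
    unfolding card_vecs_supported_in(2)[OF U] card_mat_kernel[OF A] .
  then show ?thesis
    using CARD_field_gt_1[where 'a = 'a] by simp
qed

lemma kernel_dim_le:
  assumes "A \<in> carrier_mat m n"
  shows "kernel_dim A \<le> n"
  using assms by (auto simp: kernel_dim_code)

section \<open>From counting to probability\<close>

lemma measure_uniform_random_element:
  assumes X: "uniform_random_element M S X" and "finite S"
  shows "measure M {\<omega> \<in> space M. P (X \<omega>)} = card {x \<in> S. P x} / card S"
proof -
  have X: "X \<in> measurable M (count_space S)" "distr M (count_space S) X = uniform_count_measure S"
    using X by (auto simp: uniform_random_element_def)
  have "{\<omega> \<in> space M. P (X \<omega>)} = X -` {x \<in> S. P x} \<inter> space M"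
    using measurable_space[OF X(1)] by auto
  then have "measure M {\<omega> \<in> space M. P (X \<omega>)} = measure (distr M (count_space S) X) {x \<in> S. P x}"
    using X(1) by (simp add: measure_distr)
  also have "\<dots> = card {x \<in> S. P x} / card S"
    unfolding X(2) using \<open>finite S\<close> by (subst measure_uniform_count_measure) auto
  finally show ?thesis .
qed

text \<open>Markov's inequality for the kernel size, which is at least
  \<open>2 ^ kernel_dim A\<close> because the field has at least two elements. Base 2 matches the
  count of sets of blocks.\<close>

lemma frac_large_kernel_band_le:
  fixes \<epsilon> :: real
  assumes "n \<ge> 1" "\<epsilon> > 0"
  shows "card {A \<in> band_matrices n w :: 'a::{field,finite} mat set. real (kernel_dim A) / real n > \<epsilon>}
           / card (band_matrices n w :: 'a mat set)
         \<le> 2 powr (real n / real (w + 1) + 1 - \<epsilon> * real n)"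
proof -
  let ?S = "band_matrices n w :: 'a mat set"
  let ?L = "{A \<in> ?S. real (kernel_dim A) / real n > \<epsilon>}"
  have "card ?L * 2 powr (\<epsilon> * n) = (\<Sum>A\<in>?L. 2 powr (\<epsilon> * n))" by simp
  also have "\<dots> \<le> (\<Sum>A\<in>?L. real (card (mat_kernel A)))"
  proof (rule sum_mono)
    fix A assume A: "A \<in> ?L"
    then have car: "A \<in> carrier_mat n n" by (auto simp: band_matrices_def)
    have "\<epsilon> * n \<le> kernel_dim A" using A assms by (simp add: field_simps)
    then have "2 powr (\<epsilon> * n) \<le> 2 powr kernel_dim A" by simp
    also have "\<dots> = 2 ^ kernel_dim A" by (simp add: powr_realpow)
    also have "\<dots> \<le> real CARD('a) ^ kernel_dim A"
      using CARD_field_gt_1[where 'a = 'a] by (intro power_mono) auto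
    finally show "2 powr (\<epsilon> * n) \<le> real (card (mat_kernel A))"
      by (simp add: card_mat_kernel[OF car])
  qed
  also have "\<dots> \<le> (\<Sum>A\<in>?S. real (card (mat_kernel A)))"
    by (rule sum_mono2) (auto simp: finite_band_matrices)
  also have "\<dots> \<le> real (2 ^ (n div (w + 1) + 1) * card ?S)"
    using sum_card_mat_kernel_band[of n w, where 'a = 'a]
    by (simp only: of_nat_sum[symmetric] of_nat_le_iff)
  also have "\<dots> = 2 powr (real (n div (w + 1)) + 1) * card ?S"
    by (simp add: powr_add powr_realpow)
  also have "\<dots> \<le> 2 powr (real n / real (w + 1) + 1) * card ?S"
    by (intro mult_right_mono powr_mono add_right_mono of_nat_div_le_of_nat) auto
  finally show ?thesis
    unfolding powr_diff using card_band_matrices_pos[of n w, where 'a = 'a]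
    by (simp only: divide_le_eq pos_le_divide_eq powr_gt_zero of_nat_0_less_iff if_True times_divide_eq_left)
qed

text \<open>Reverse Markov inequality: \<open>c\<close> bounds from below the probability that a
  given column vanishes, hence also the mean of \<open>kernel_dim A / n\<close>, which never exceeds
  1.\<close>

lemma frac_large_kernel_band_ge:
  fixes K :: nat and c :: real
  assumes "n \<ge> 1" "w \<le> K"
  defines "c \<equiv> 1 / real CARD('a) ^ (2 * K + 1)"
  shows "c / 2 \<le> card {A \<in> band_matrices n w :: 'a::{field,finite} mat set. real (kernel_dim A) / real n > c / 2}
           / card (band_matrices n w :: 'a mat set)"
proof -
  let ?S = "band_matrices n w :: 'a mat set"
  let ?L = "{A \<in> ?S. real (kernel_dim A) / real n > c / 2}"
  let ?z = "\<lambda>A :: 'a mat. {j. j \<in> {..<n} \<and> (\<forall>i<n. A $$ (i, j) = 0)}"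
  have q: "real CARD('a) > 1" using CARD_field_gt_1[where 'a = 'a] by simp
  have col: "c * card ?S \<le> card {A. A \<in> ?S \<and> (\<forall>i<n. A $$ (i, j) = 0)}" if "j < n" for j
  proof -
    let ?Z = "{A. A \<in> ?S \<and> (\<forall>i<n. A $$ (i, j) = 0)}"
    have "real (card ?S) \<le> real (card ?Z * CARD('a) ^ (2 * w + 1))"
      using card_band_matrices_zero_col[OF that, of w, where 'a = 'a] by (simp only: of_nat_le_iff)
    also have "\<dots> \<le> card ?Z * real CARD('a) ^ (2 * K + 1)"
      unfolding of_nat_mult of_nat_power using q \<open>w \<le> K\<close> by (intro mult_left_mono power_increasing) auto
    finally show ?thesis
      using q by (simp add: c_def field_simps)
  qed
  have "n * (c * card ?S) = (\<Sum>j<n. c * card ?S)" by simp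
  also have "\<dots> \<le> (\<Sum>j<n. real (card {A. A \<in> ?S \<and> (\<forall>i<n. A $$ (i, j) = 0)}))"
    using col by (intro sum_mono) auto
  also have "\<dots> = (\<Sum>j<n. \<Sum>A\<in>{A. A \<in> ?S \<and> (\<forall>i<n. A $$ (i, j) = 0)}. 1)" by simp
  also have "\<dots> = (\<Sum>A\<in>?S. \<Sum>j\<in>?z A. 1)"
    by (rule sum.swap_restrict[symmetric]) (auto simp: finite_band_matrices)
  also have "\<dots> \<le> (\<Sum>A\<in>?S. real (kernel_dim A))"
  proof (rule sum_mono)
    fix A assume "A \<in> ?S"
    then show "(\<Sum>j\<in>?z A. 1) \<le> real (kernel_dim A)"
      using card_zero_cols_le_kernel_dim[of A n n] by (simp add: band_matrices_def)
  qed
  \<comment> \<open>Outside \<open>?L\<close> the dimension is at most \<open>n * c / 2\<close>;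
    inside, the trivial bound \<open>n\<close> is used.\<close>
  also have "\<dots> \<le> (\<Sum>A\<in>?S. n * c / 2 + (if A \<in> ?L then real n else 0))"
  proof (rule sum_mono)
    fix A assume A: "A \<in> ?S"
    then have "kernel_dim A \<le> n" by (auto simp: band_matrices_def intro: kernel_dim_le)
    moreover have "0 \<le> n * c / 2" by (simp add: c_def)
    ultimately show "real (kernel_dim A) \<le> n * c / 2 + (if A \<in> ?L then real n else 0)"
      using A \<open>n \<ge> 1\<close> by (auto simp: field_simps)
  qed
  also have "\<dots> = card ?S * (n * c / 2) + n * card ?L"
    by (simp add: sum.distrib finite_band_matrices sum.If_cases Int_def conj_commute)
  finally have "real n * (c / 2 * card ?S) \<le> real n * card ?L"
    by (simp add: field_simps)
  then have "c / 2 * card ?S \<le> card ?L"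
    using \<open>n \<ge> 1\<close> by simp
  then show ?thesis
    using card_band_matrices_pos[of n w, where 'a = 'a] by (simp add: field_simps)
qed

theorem theorem6:
  fixes w :: "nat \<Rightarrow> nat"
    and M :: "nat \<Rightarrow> 'w measure"
    and B :: "nat \<Rightarrow> 'w \<Rightarrow> 'p::prime_card mod_ring mat"
  assumes "\<And>n. n \<ge> 1 \<Longrightarrow> w n > 0"
    and "\<And>n. n \<ge> 1 \<Longrightarrow> prob_space (M n)"
    and "\<And>n. n \<ge> 1 \<Longrightarrow> uniform_random_element (M n) (band_matrices n (w n)) (B n)"
  shows "tendsto_in_probability M (\<lambda>n \<omega>. real (kernel_dim (B n \<omega>)) / real n) 0
           \<longleftrightarrow> filterlim w at_top sequentially"
proof -
  let ?P = "\<lambda>\<epsilon> n. measure (M n) {\<omega> \<in> space (M n). \<bar>real (kernel_dim (B n \<omega>)) / real n - 0\<bar> > \<epsilon>}"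
  \<comment> \<open>The hypotheses concern only \<open>n \<ge> 1\<close>; the limits below need the
    formula only eventually.\<close>
  have P: "?P \<epsilon> n = card {A \<in> band_matrices n (w n) :: 'p mod_ring mat set. real (kernel_dim A) / real n > \<epsilon>}
           / card (band_matrices n (w n) :: 'p mod_ring mat set)" if "n \<ge> 1" for \<epsilon> n
    using measure_uniform_random_element[OF assms(3)[OF that] finite_band_matrices] by simp
  show ?thesis
  proof
    assume lim: "filterlim w at_top sequentially"
    show "tendsto_in_probability M (\<lambda>n \<omega>. real (kernel_dim (B n \<omega>)) / real n) 0"
      unfolding tendsto_in_probability_def
    proof (intro allI impI)
      fix \<epsilon> :: real assume \<epsilon>: "\<epsilon> > 0"
      \<comment> \<open>The threshold makes the block term \<open>n / (w n + 1)\<close> at most half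
        of \<open>\<epsilon> * n\<close>, so the exponent still tends to minus infinity.\<close>
      have "\<forall>\<^sub>F n in sequentially. w n \<ge> nat \<lceil>2 / \<epsilon>\<rceil>"
        using lim unfolding filterlim_at_top by blast
      then have ev: "\<forall>\<^sub>F n in sequentially. ?P \<epsilon> n \<le> 2 powr (1 - \<epsilon> / 2 * real n)"
        using eventually_ge_at_top[of 1]
      proof eventually_elim
        case (elim n)
        have "2 / \<epsilon> \<le> real (w n + 1)" using elim(1) by linarith
        then have "1 / real (w n + 1) \<le> \<epsilon> / 2"
          using \<epsilon> by (simp add: field_simps)
        then have "real n / real (w n + 1) \<le> \<epsilon> / 2 * n"
          using mult_right_mono[of "1 / real (w n + 1)" "\<epsilon> / 2" "real n"] by simp
        then have "2 powr (real n / real (w n + 1) + 1 - \<epsilon> * real n) \<le> 2 powr (1 - \<epsilon> / 2 * real n)"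
          by (intro powr_mono) linarith+
        with frac_large_kernel_band_le[OF elim(2) \<epsilon>, of "w n", where 'a = "'p mod_ring"]
        show ?case unfolding P[OF elim(2)] by linarith
      qed
      have "(\<lambda>n. 2 powr (1 - \<epsilon> / 2 * real n)) \<longlonglongrightarrow> 0"
        using \<epsilon> by real_asymp
      then show "?P \<epsilon> \<longlonglongrightarrow> 0"
        by (intro real_tendsto_sandwich[OF _ ev tendsto_const]) simp_all
    qed
  next
    assume conv: "tendsto_in_probability M (\<lambda>n \<omega>. real (kernel_dim (B n \<omega>)) / real n) 0"
    show "filterlim w at_top sequentially"
      unfolding filterlim_at_top
    proof
      fix K
      \<comment> \<open>With this \<open>c\<close>, every \<open>n \<ge> 1\<close> with
        \<open>w n < K\<close> has probability at least \<open>c / 2\<close> of exceeding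
        \<open>c / 2\<close>, which convergence allows for only finitely many
        \<open>n\<close>.\<close>
      define c where "c = 1 / real CARD('p mod_ring) ^ (2 * K + 1)"
      have c: "c > 0"
        using CARD_field_gt_1[where 'a = "'p mod_ring"] unfolding c_def
        by (intro divide_pos_pos zero_less_power) linarith+
      then have "?P (c / 2) \<longlonglongrightarrow> 0"
        using conv unfolding tendsto_in_probability_def by (meson half_gt_zero)
      then have "\<forall>\<^sub>F n in sequentially. ?P (c / 2) n < c / 2"
        using c by (intro order_tendstoD) auto
      then show "\<forall>\<^sub>F n in sequentially. K \<le> w n"
        using eventually_ge_at_top[of 1]
      proof eventually_elim
        case (elim n)
        show ?case
        proof (rule ccontr)
          assume "\<not> K \<le> w n"
          then have "c / 2 \<le> ?P (c / 2) n"
            unfolding P[OF elim(2)] c_def by (intro frac_large_kernel_band_ge elim(2)) simp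
          with elim(1) show False by simp
        qed
      qed
    qed
  qed
qed

end
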